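(* The method EP for the charged-particle system $\ddot{x}=\dot{x}\times B(x)+F(x)$, $F=-\nabla U$ (defined in the context) preserves the energy $E(x,v)=\frac12|v|^2+U(x)$ exactly, i.e. its numerical solution satisfies $$E(x_{n+1},v_{n+1})=E(x_n,v_n)\qquad\text{for } n=0,1,\ldots$$
   Context: Charged-particle dynamics: $x(t)\in\mathbb{R}^3$ solves $\ddot{x}=\dot{x}\times B(x)+F(x)$, where $B(x)=\nabla_x\times A(x)$ for a vector potential $A(x)\in\mathbb{R}^3$ and $F(x)=-\nabla U(x)$ for a scalar potential $U(x)\in\mathbb{R}$ (the potentials are assumed sufficiently smooth). Write $v=\dot{x}$ and $B=(B_1,B_2,B_3)^{\intercal}$, and let $$\tilde{B}(x)=\begin{pmatrix}0&B_3(x)&-B_2(x)\\-B_3(x)&0&B_1(x)\\ B_2(x)&-B_1(x)&0\end{pmatrix},$$ so that $\dot{x}\times B(x)=\tilde{B}(x)\dot{x}$. Method EP: for stepsize $h$, $(x_{n+1},v_{n+1})$ is defined implicitly from $(x_n,v_n)$ by $$x_{n+1}=x_n+hv_n+\tfrac{h^2}{2}\int_0^1F(x_n+\tau(x_{n+1}-x_n))\,d\tau+\tfrac{h^2}{2}\tilde{B}\big(\tfrac{x_{n+1}+x_n}{2}\big)\tfrac{v_{n+1}+v_n}{2},$$ $$v_{n+1}=v_n+h\int_0^1F(x_n+\tau(x_{n+1}-x_n))\,d\tau+h\tilde{B}\big(\tfrac{x_{n+1}+x_n}{2}\big)\tfrac{v_{n+1}+v_n}{2}.$$ *)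

theory Defs
  imports "HOL-Analysis.Analysis"
begin

definition continuously_differentiable ::
    "('a::real_normed_vector \<Rightarrow> 'b::real_normed_vector) \<Rightarrow> bool" where
  "continuously_differentiable f \<longleftrightarrow>
     (\<exists>f' :: 'a \<Rightarrow> 'a \<Rightarrow>\<^sub>L 'b.
        (\<forall>x. (f has_derivative blinfun_apply (f' x)) (at x)) \<and> continuous_on UNIV f')"

(* Partial derivative of f at x in the j-th coordinate. Meaningful only where f is
   differentiable, since frechet_derivative is a choice operator. *)
definition partial_deriv ::
    "3 \<Rightarrow> (real^3 \<Rightarrow> 'b::real_normed_vector) \<Rightarrow> real^3 \<Rightarrow> 'b" where
  "partial_deriv j f x = frechet_derivative f (at x) (axis j 1)"

definition grad :: "(real^3 \<Rightarrow> real) \<Rightarrow> real^3 \<Rightarrow> real^3" where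
  "grad U x = (\<chi> i. partial_deriv i U x)"

definition curl :: "(real^3 \<Rightarrow> real^3) \<Rightarrow> real^3 \<Rightarrow> real^3" where
  "curl A x = vector
     [partial_deriv 2 A x $ 3 - partial_deriv 3 A x $ 2,
      partial_deriv 3 A x $ 1 - partial_deriv 1 A x $ 3,
      partial_deriv 1 A x $ 2 - partial_deriv 2 A x $ 1]"

definition skew_mat :: "real^3 \<Rightarrow> real^3^3" where
  "skew_mat b = vector
     [vector [0, b $ 3, - (b $ 2)],
      vector [- (b $ 3), 0, b $ 1],
      vector [b $ 2, - (b $ 1), 0]]"

(* One step (x, v) to (x', v') of EP with stepsize h. The scheme is implicit, hence a
   relation: solvability for (x', v') depends on h, F and B. *)
definition EP_step ::
    "(real^3 \<Rightarrow> real^3) \<Rightarrow> (real^3 \<Rightarrow> real^3) \<Rightarrow> real \<Rightarrow>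
     real^3 \<Rightarrow> real^3 \<Rightarrow> real^3 \<Rightarrow> real^3 \<Rightarrow> bool" where
  "EP_step B F h x v x' v' \<longleftrightarrow>
     x' = x + h *\<^sub>R v
            + (h\<^sup>2 / 2) *\<^sub>R integral {0..1} (\<lambda>\<tau>. F (x + \<tau> *\<^sub>R (x' - x)))
            + (h\<^sup>2 / 2) *\<^sub>R (skew_mat (B ((1 / 2) *\<^sub>R (x' + x))) *v ((1 / 2) *\<^sub>R (v' + v))) \<and>
     v' = v + h *\<^sub>R integral {0..1} (\<lambda>\<tau>. F (x + \<tau> *\<^sub>R (x' - x)))
            + h *\<^sub>R (skew_mat (B ((1 / 2) *\<^sub>R (x' + x))) *v ((1 / 2) *\<^sub>R (v' + v)))"

definition energy :: "(real^3 \<Rightarrow> real) \<Rightarrow> real^3 \<Rightarrow> real^3 \<Rightarrow> real" where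
  "energy U x v = (1 / 2) * (norm v)\<^sup>2 + U x"

lemma skew_mat_mult_eq_cross3: "skew_mat b *v v = cross3 v b"
  by (simp add: skew_mat_def cross3_def vec_eq_iff forall_3 matrix_vector_mult_def sum_3
      vector_3 algebra_simps)

lemma GDERIV_grad:
  assumes "U differentiable (at x)"
  shows "GDERIV U x :> grad U x"
proof -
  let ?D = "frechet_derivative U (at x)"
  have D: "(U has_derivative ?D) (at x)"
    using assms by (simp add: frechet_derivative_works)
  then have lin: "linear ?D"
    by (rule has_derivative_linear)
  have "?D y = y \<bullet> grad U x" for y
  proof -
    have "y = (\<Sum>i\<in>UNIV. (y $ i) *\<^sub>R axis i 1)"
      by (simp add: basis_expansion flip: scalar_mult_eq_scaleR)
    then have "?D y = ?D (\<Sum>i\<in>UNIV. (y $ i) *\<^sub>R axis i 1)"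
      by simp
    also have "\<dots> = y \<bullet> grad U x"
      by (simp add: linear_sum[OF lin] linear_cmul[OF lin] inner_vec_def grad_def
          partial_deriv_def)
    finally show ?thesis .
  qed
  then have "?D = (\<lambda>y. y \<bullet> grad U x)" by (rule ext)
  with D show ?thesis by (simp add: gderiv_def)
qed

end

theory Submission
  imports Defs
begin

text \<open>
  Write \<open>w = (v + v') / 2\<close> for the mean velocity of a step and \<open>I\<close> for the average of \<open>F\<close> over
  the segment from \<open>x\<close> to \<open>x'\<close>. Subtracting \<open>h / 2\<close> times the velocity update from the position
  update cancels both forces and leaves \<open>x' - x = h w\<close> (\<open>EP_step_displacement\<close>). The kinetic
  energy changes by \<open>(v' - v) \<bullet> w\<close>, and the velocity update turns this into
  \<open>h I \<bullet> w = I \<bullet> (x' - x)\<close> (\<open>EP_step_kinetic_energy\<close>): the discrete magnetic force is a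
  skew-symmetric matrix applied to \<open>w\<close>, hence orthogonal to \<open>w\<close>. Since \<open>I\<close> is the exact average of
  \<open>- grad U\<close>, the fundamental theorem of calculus along the segment identifies \<open>I \<bullet> (x' - x)\<close> with
  the loss \<open>U x - U x'\<close> of potential energy (\<open>averaged_gradient_inner_displacement\<close>).
\<close>

lemma skew_mat_mult_orthogonal: "(skew_mat b *v w) \<bullet> w = 0"
  by (simp add: skew_mat_mult_eq_cross3 dot_cross_self)

text \<open>
  Continuity of the gradient is what makes its average over a segment a genuine integral;
  for a non-integrable integrand the integral would be the default value \<open>0\<close>.
\<close>

lemma continuously_differentiable_imp_continuous_grad:
  assumes "continuously_differentiable U"
  shows "continuous_on UNIV (grad U)"
proof -
  from assms obtain U' where
    deriv: "\<And>y. (U has_derivative blinfun_apply (U' y)) (at y)"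
    and cont: "continuous_on UNIV U'"
    unfolding continuously_differentiable_def by blast
  have "grad U = (\<lambda>y. \<chi> i. blinfun_apply (U' y) (axis i 1))"
    by (simp add: fun_eq_iff grad_def partial_deriv_def frechet_derivative_at[OF deriv, symmetric])
  then show ?thesis
    using cont by (auto intro!: continuous_intros)
qed

text \<open>
  This is the mean value property that makes the averaged gradient a discrete gradient:
  pairing it with the displacement integrates the derivative of \<open>\<tau> \<mapsto> U (x + \<tau> (x' - x))\<close>.
\<close>

lemma averaged_gradient_inner_displacement:
  assumes "continuously_differentiable U"
  shows "integral {0..1} (\<lambda>\<tau>. grad U (x + \<tau> *\<^sub>R (x' - x))) \<bullet> (x' - x) = U x' - U x"
proof -
  let ?\<gamma> = "\<lambda>\<tau>::real. x + \<tau> *\<^sub>R (x' - x)"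
  have diff: "U differentiable (at y)" for y
    using assms unfolding continuously_differentiable_def differentiable_def by blast
  have deriv: "((\<lambda>\<tau>. U (?\<gamma> \<tau>)) has_vector_derivative grad U (?\<gamma> \<tau>) \<bullet> (x' - x)) (at \<tau> within {0..1})"
    for \<tau>
  proof -
    have "(?\<gamma> has_derivative (\<lambda>t. t *\<^sub>R (x' - x))) (at \<tau> within {0..1})"
      by (auto intro!: derivative_eq_intros)
    moreover have "(U has_derivative (\<lambda>y. y \<bullet> grad U (?\<gamma> \<tau>))) (at (?\<gamma> \<tau>))"
      using GDERIV_grad[OF diff] by (simp add: gderiv_def)
    ultimately have "((\<lambda>\<tau>. U (?\<gamma> \<tau>)) has_derivative (\<lambda>t. (t *\<^sub>R (x' - x)) \<bullet> grad U (?\<gamma> \<tau>)))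
        (at \<tau> within {0..1})"
      by (rule has_derivative_compose)
    then show ?thesis
      by (simp add: has_vector_derivative_def inner_commute)
  qed
  have "((\<lambda>\<tau>. grad U (?\<gamma> \<tau>) \<bullet> (x' - x)) has_integral U (?\<gamma> 1) - U (?\<gamma> 0)) {0..1}"
    by (rule fundamental_theorem_of_calculus) (use deriv in auto)
  then have ftc: "((\<lambda>\<tau>. grad U (?\<gamma> \<tau>) \<bullet> (x' - x)) has_integral U x' - U x) {0..1}"
    by simp
  have "continuous_on {0..1} (\<lambda>\<tau>. grad U (?\<gamma> \<tau>))"
    by (rule continuous_on_compose2[OF continuously_differentiable_imp_continuous_grad[OF assms]])
      (auto intro!: continuous_intros)
  then have "(\<lambda>\<tau>. grad U (?\<gamma> \<tau>)) integrable_on {0..1}"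
    by (rule integrable_continuous_real)
  from has_integral_linear[OF integrable_integral[OF this] bounded_linear_inner_left]
  have "((\<lambda>\<tau>. grad U (?\<gamma> \<tau>) \<bullet> (x' - x)) has_integral
      integral {0..1} (\<lambda>\<tau>. grad U (?\<gamma> \<tau>)) \<bullet> (x' - x)) {0..1}"
    by (simp add: o_def)
  from has_integral_unique[OF this ftc] show ?thesis .
qed

text \<open>
  Both updates contain the same total force, so the position update is \<open>x + h v\<close> plus \<open>h / 2\<close>
  times the velocity increment; this makes the displacement that of the trapezoidal rule.
\<close>

lemma EP_step_displacement:
  assumes "EP_step B F h x v x' v'"
  shows "x' - x = h *\<^sub>R ((1 / 2) *\<^sub>R (v' + v))"
proof -
  define I where "I = integral {0..1} (\<lambda>\<tau>. F (x + \<tau> *\<^sub>R (x' - x)))"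
  define m where "m = skew_mat (B ((1 / 2) *\<^sub>R (x' + x))) *v ((1 / 2) *\<^sub>R (v' + v))"
  have x': "x' = x + h *\<^sub>R v + (h\<^sup>2 / 2) *\<^sub>R I + (h\<^sup>2 / 2) *\<^sub>R m"
    and v': "v' = v + h *\<^sub>R I + h *\<^sub>R m"
    using assms unfolding EP_step_def I_def m_def by blast+
  have "x' - x = h *\<^sub>R v + (h / 2) *\<^sub>R (h *\<^sub>R I + h *\<^sub>R m)"
    by (subst x') (simp add: algebra_simps power2_eq_square)
  also have "h *\<^sub>R I + h *\<^sub>R m = v' - v"
    by (subst v') simp
  also have "h *\<^sub>R v + (h / 2) *\<^sub>R (v' - v) = h *\<^sub>R ((1 / 2) *\<^sub>R (v' + v))"
    by (simp add: vec_eq_iff field_simps)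
  finally show ?thesis .
qed

text \<open>
  A discrete work-energy balance. Expanding \<open>(v' - v) \<bullet> (v' + v) / 2\<close> with the velocity update
  leaves only the work of the averaged force, since the magnetic term is orthogonal to the
  mean velocity, which in turn is parallel to the displacement.
\<close>

lemma EP_step_kinetic_energy:
  assumes "EP_step B F h x v x' v'"
  shows "(1 / 2) * (norm v')\<^sup>2 - (1 / 2) * (norm v)\<^sup>2
    = integral {0..1} (\<lambda>\<tau>. F (x + \<tau> *\<^sub>R (x' - x))) \<bullet> (x' - x)"
proof -
  define I where "I = integral {0..1} (\<lambda>\<tau>. F (x + \<tau> *\<^sub>R (x' - x)))"
  define w where "w = (1 / 2) *\<^sub>R (v' + v)"
  define M where "M = skew_mat (B ((1 / 2) *\<^sub>R (x' + x)))"
  have v': "v' = v + h *\<^sub>R I + h *\<^sub>R (M *v w)"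
    using assms unfolding EP_step_def I_def M_def w_def by blast
  have "(1 / 2) * (norm v')\<^sup>2 - (1 / 2) * (norm v)\<^sup>2 = (v' - v) \<bullet> w"
    by (simp add: w_def power2_norm_eq_inner inner_diff_left inner_diff_right
        inner_add_left inner_add_right inner_commute field_simps)
  also have "v' - v = h *\<^sub>R I + h *\<^sub>R (M *v w)"
    by (subst v') simp
  also have "(h *\<^sub>R I + h *\<^sub>R (M *v w)) \<bullet> w = I \<bullet> (h *\<^sub>R w)"
    by (simp add: inner_add_left M_def skew_mat_mult_orthogonal)
  also have "h *\<^sub>R w = x' - x"
    using EP_step_displacement[OF assms] by (simp add: w_def)
  finally show ?thesis
    by (simp add: I_def)
qed

theorem theorem3p1:
  fixes U :: "real^3 \<Rightarrow> real"
    and A B F :: "real^3 \<Rightarrow> real^3"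
    and h :: real
    and x v :: "nat \<Rightarrow> real^3"
  assumes "continuously_differentiable U"
    and "continuously_differentiable A"
    and "\<And>y. B y = curl A y"
    and "\<And>y. F y = - grad U y"
    and "\<And>n. EP_step B F h (x n) (v n) (x (Suc n)) (v (Suc n))"
  shows "\<forall>n. energy U (x (Suc n)) (v (Suc n)) = energy U (x n) (v n)"
proof
  fix n
  let ?g = "\<lambda>\<tau>. grad U (x n + \<tau> *\<^sub>R (x (Suc n) - x n))"
  have "(1 / 2) * (norm (v (Suc n)))\<^sup>2 - (1 / 2) * (norm (v n))\<^sup>2
      = integral {0..1} (\<lambda>\<tau>. - ?g \<tau>) \<bullet> (x (Suc n) - x n)"
    using EP_step_kinetic_energy[OF assms(5)[of n]] by (simp only: assms(4))
  also have "\<dots> = - (integral {0..1} ?g \<bullet> (x (Suc n) - x n))"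
    by simp
  also have "\<dots> = U (x n) - U (x (Suc n))"
    by (simp add: averaged_gradient_inner_displacement[OF assms(1)])
  finally show "energy U (x (Suc n)) (v (Suc n)) = energy U (x n) (v n)"
    by (simp add: energy_def)
qed

end
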